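(* Let $\beta\in\mathcal M_{\mathrm{si}}(\Omega_0)$ be ergodic (with respect to the flow $(\theta_t)_{t\in\mathbb R}$). Then either $$\lim_{\varepsilon\to0}\mathbb E^{\beta}\Big[\varepsilon\int_0^\infty e^{-\varepsilon t}\,V(\omega(t)-\omega(0))\,\mathrm dt\Big]=0$$ for all continuous $V:\mathbb R^d\to\mathbb R$ with $\lim_{|x|\to\infty}|V(x)|=0$, or there is a $\theta_t$-invariant probability measure $\mathbb Q\in\mathcal M_{\mathrm s}(\Omega_0\otimes\mathbb R^d)$ with $\mathbb Q^{(1)}=\beta$, i.e. $\beta$ is the distribution of the increments of a stationary process.
   Context: Let $d\ge1$ and let $\Omega_0$ be the space of continuous $\omega:\mathbb R\to\mathbb R^d$ with $\omega(0)=0$, with the topology of uniform convergence on bounded intervals. For $t\in\mathbb R$, $\theta_t:\Omega_0\to\Omega_0$ is $(\theta_t\omega)(s)=\omega(t+s)-\omega(t)$, and $\theta_t:\Omega_0\otimes\mathbb R^d\to\Omega_0\otimes\mathbb R^d$ is $\theta_t(\omega,x)=(\theta_t\omega,x+\omega(t))$. $\mathcal M_{\mathrm{si}}(\Omega_0)$ is the set of probability measures on $\Omega_0$ invariant under all $\theta_t$ (processes with stationary increments), and $\mathcal M_{\mathrm s}(\Omega_0\otimes\mathbb R^d)$ the set of probability measures on $\Omega_0\otimes\mathbb R^d$ invariant under all $\theta_t$ (stationary processes, identifying a continuous path $\omega:\mathbb R\to\mathbb R^d$ with $(\omega-\omega(0),\omega(0))$). For a measure $\mathbb Q$ on $\Omega_0\otimes\mathbb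 R^d$, $\mathbb Q^{(1)}$ is its marginal on $\Omega_0$. *)

theory Defs
  imports "HOL-Probability.Probability"
begin

definition Omega0 :: "(real \<Rightarrow> 'a::euclidean_space) set" where
  "Omega0 = {\<omega>. continuous_on UNIV \<omega> \<and> \<omega> 0 = 0}"

text \<open>Measurable structure on Omega_0: the cylinder sigma-algebra (generated by the
  evaluation maps), which coincides with the Borel sigma-algebra of the topology of
  uniform convergence on bounded intervals.\<close>
definition Omega0_M :: "(real \<Rightarrow> 'a::euclidean_space) measure" where
  "Omega0_M = restrict_space (PiM UNIV (\<lambda>_. borel)) Omega0"

definition Omega0R_M :: "((real \<Rightarrow> 'a::euclidean_space) \<times> 'a) measure" where
  "Omega0R_M = Omega0_M \<Otimes>\<^sub>M borel"

definition shift :: "real \<Rightarrow> (real \<Rightarrow> 'a::euclidean_space) \<Rightarrow> (real \<Rightarrow> 'a)" where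
  "shift t \<omega> = (\<lambda>s. \<omega> (t + s) - \<omega> t)"

definition shift_pair :: "real \<Rightarrow> (real \<Rightarrow> 'a::euclidean_space) \<times> 'a \<Rightarrow> (real \<Rightarrow> 'a) \<times> 'a" where
  "shift_pair t p = (shift t (fst p), snd p + fst p t)"

definition M_si :: "(real \<Rightarrow> 'a::euclidean_space) measure set" where
  "M_si = {\<beta>. prob_space \<beta> \<and> sets \<beta> = sets Omega0_M \<and>
              (\<forall>t. distr \<beta> Omega0_M (shift t) = \<beta>)}"

definition M_s :: "((real \<Rightarrow> 'a::euclidean_space) \<times> 'a) measure set" where
  "M_s = {Q. prob_space Q \<and> sets Q = sets Omega0R_M \<and>
              (\<forall>t. distr Q Omega0R_M (shift_pair t) = Q)}"

definition ergodic_flow :: "(real \<Rightarrow> 'a::euclidean_space) measure \<Rightarrow> bool" where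
  "ergodic_flow \<beta> \<longleftrightarrow>
     (\<forall>A \<in> sets \<beta>. (\<forall>t. shift t -` A \<inter> space \<beta> = A) \<longrightarrow>
        emeasure \<beta> A = 0 \<or> emeasure \<beta> A = 1)"

end

theory Submission
  imports Defs
begin

text \<open>
  The skew product flow \<open>shift_pair t\<close> preserves the \<open>\<sigma>\<close>-finite measure \<open>\<beta> \<otimes> Lebesgue\<close>. Let
  \<open>G R (\<omega>, x)\<close> be the upper density of the times at which \<open>x + \<omega>\<close> visits the ball of radius \<open>R\<close>;
  it is strictly invariant under the flow. By Hopf's maximal inequality the invariant level sets
  \<open>{G R > c}\<close>, \<open>c > 0\<close>, have finite measure. If one of them has positive measure, the normalised
  restriction of \<open>\<beta> \<otimes> Lebesgue\<close> to it is a stationary law, and by ergodicity its marginal is \<open>\<beta>\<close>,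
  since the Lebesgue measure of the section over \<open>\<omega>\<close> is an invariant function of \<open>\<omega>\<close>.
  Otherwise almost every path spends a vanishing fraction of time in every ball, which makes the
  Abel means of \<open>V\<close> along the path vanish.
\<close>

subsection \<open>The maximal inequality\<close>

text \<open>Garsia's argument for the maximal ergodic theorem. The running maximum
  \<open>P N\<close> of the partial sums satisfies \<open>P N z - P N (T z) \<le> f z\<close> where
  some partial sum is positive and \<open>P N z - P N (T z) \<le> 0\<close> elsewhere; the left side
  has integral zero because \<open>T\<close> preserves \<open>M\<close>. Only \<open>f\<close> has
  to be integrable, so \<open>M\<close> may be infinite.\<close>

lemma Garsia:
  fixes f :: "'a \<Rightarrow> real"
  assumes T: "T \<in> measurable M M" and inv: "distr M M T = M" and f: "integrable M f"
  defines "S \<equiv> \<lambda>n z. \<Sum>k<n. f ((T ^^ k) z)"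
  shows "0 \<le> (\<integral>z. indicator {z \<in> space M. \<exists>n\<le>N. 0 < S n z} z * f z \<partial>M)"
proof -
  \<comment> \<open>The index 0 is included and \<open>S 0 z = 0\<close>, so \<open>P n\<close> is
    nonnegative.\<close>
  define P where "P n z = Max ((\<lambda>k. S k z) ` {..n})" for n z
  have f_comp: "integrable M (\<lambda>z. g (T z))" if "integrable M g" for g :: "'a \<Rightarrow> real"
    using integrable_distr[OF T, of g] that inv by simp
  have int_comp: "(\<integral>z. g (T z) \<partial>M) = (\<integral>z. g z \<partial>M)" if "integrable M g" for g :: "'a \<Rightarrow> real"
    using integral_distr[OF T, of g] that inv by simp
  have fk: "integrable M (\<lambda>z. f ((T ^^ k) z))" for k
  proof (induction k)
    case (Suc k) show ?case using f_comp[OF Suc] by (simp add: funpow_swap1)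
  qed (simp add: f)
  have S_int: "integrable M (S n)" for n
    unfolding S_def using fk by (intro Bochner_Integration.integrable_sum) auto
  have P_Suc: "P (Suc n) z = max (S (Suc n) z) (P n z)" for n z
    by (simp add: P_def atMost_Suc)
  have P_int: "integrable M (P n)" for n
  proof (induction n)
    case 0 show ?case using S_int[of 0] by (simp add: P_def[abs_def])
  next
    case (Suc n) show ?case
      using integrable_max[OF S_int[of "Suc n"] Suc] by (simp add: P_Suc[abs_def])
  qed
  have P_ge: "S k z \<le> P n z" if "k \<le> n" for k n z
    unfolding P_def using that by (intro Max_ge) auto
  have P_nonneg: "0 \<le> P n z" for n z
    using P_ge[of 0 n z] by (simp add: S_def)
  \<comment> \<open>The first summand is split off rather than the last, which leaves a partial sum
    started at \<open>T z\<close>.\<close>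
  have S_Suc: "S (Suc k) z = f z + S k (T z)" for k z
    unfolding S_def sum.lessThan_Suc_shift by (simp add: funpow_swap1)
  define B where "B = {z \<in> space M. \<exists>n\<le>N. 0 < S n z}"
  have [measurable]: "S n \<in> borel_measurable M" "P n \<in> borel_measurable M" for n
    using S_int P_int by auto
  have [measurable]: "B \<in> sets M" unfolding B_def by measurable
  have key: "P N z - P N (T z) \<le> indicator B z * f z" if z: "z \<in> space M" for z
  proof (cases "z \<in> B")
    case True
    have "P N z \<in> (\<lambda>k. S k z) ` {..N}" unfolding P_def by (intro Max_in) auto
    then obtain k where k: "k \<le> N" "P N z = S k z" by auto
    obtain n where n: "n \<le> N" "0 < S n z" using True by (auto simp: B_def)
    \<comment> \<open>The maximising index is not 0, because \<open>S 0 z = 0\<close> while the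
      maximum is positive.\<close>
    have "0 < S k z" using P_ge[OF n(1), of z] n k by simp
    then obtain j where j: "k = Suc j" by (cases k) (auto simp: S_def)
    have "P N z = f z + S j (T z)" using k j S_Suc by simp
    also have "\<dots> \<le> f z + P N (T z)" using P_ge[of j N "T z"] k j by simp
    finally show ?thesis using True by simp
  next
    case False
    have "P N z \<le> 0"
      unfolding P_def using False z by (subst Max_le_iff) (auto simp: B_def not_less)
    then show ?thesis using False P_nonneg[of N "T z"] by simp
  qed
  \<comment> \<open>\<open>P N\<close> and its composition with \<open>T\<close> have the same
    finite integral.\<close>
  have "0 = (\<integral>z. P N z - P N (T z) \<partial>M)"
    using P_int[of N] f_comp[OF P_int[of N]] int_comp[OF P_int[of N]] by simp
  also have "\<dots> \<le> (\<integral>z. indicator B z * f z \<partial>M)"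
    using P_int[of N] f_comp[OF P_int[of N]] integrable_mult_indicator[OF \<open>B \<in> sets M\<close> f] key
    by (intro integral_mono) auto
  finally show ?thesis by (simp add: B_def)
qed

text \<open>The natural choice \<open>f - c\<close> need not be integrable when \<open>M\<close> is
  infinite. \<open>Garsia\<close> is therefore applied to \<open>f - c * indicator B\<close> with
  \<open>B\<close> a piece of the exceedance set of finite measure; this bounds
  \<open>c * measure M B\<close> by the integral of \<open>\<bar>f\<bar>\<close>, and
  \<open>B\<close> then increases to the whole set.\<close>

theorem Hopf_maximal_inequality:
  fixes f :: "'a \<Rightarrow> real"
  assumes "sigma_finite_measure M" and T[measurable]: "T \<in> measurable M M" and inv: "distr M M T = M"
    and f: "integrable M f" and c: "0 < c"
  shows "emeasure M {z \<in> space M. \<exists>n. c * real n < (\<Sum>k<n. f ((T ^^ k) z))}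
    \<le> ennreal (\<integral>z. \<bar>f z\<bar> \<partial>M) / ennreal c"
proof -
  interpret sigma_finite_measure M by fact
  have f'[measurable]: "f \<in> borel_measurable M" using f by auto
  have Tk[measurable]: "(\<lambda>z. (T ^^ k) z) \<in> measurable M M" for k
  proof (induction k)
    case (Suc k)
    have "(\<lambda>z. T ((T ^^ k) z)) \<in> measurable M M" using Suc T by (rule measurable_compose)
    then show ?case by simp
  qed simp
  define E where "E N = {z \<in> space M. \<exists>n\<le>N. c * real n < (\<Sum>k<n. f ((T ^^ k) z))}" for N :: nat
  have [measurable]: "E N \<in> sets M" for N unfolding E_def by measurable
  obtain W :: "nat \<Rightarrow> 'a set" where W: "range W \<subseteq> sets M" "(\<Union>i. W i) = space M" "\<And>i. emeasure M (W i) \<noteq> \<infinity>" "incseq W"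
    using sigma_finite_incseq by metis
  have [measurable]: "W i \<in> sets M" for i using W by auto
  have bound: "emeasure M (E N \<inter> W N) \<le> ennreal (\<integral>z. \<bar>f z\<bar> \<partial>M) / ennreal c" for N
  proof -
    define B where "B = E N \<inter> W N"
    have B[measurable]: "B \<in> sets M" unfolding B_def by measurable
    have B_fin: "emeasure M B < \<infinity>"
      using emeasure_mono[of B "W N" M] W(3)[of N] by (auto simp: B_def less_top top_unique)
    have ind: "integrable M (\<lambda>z. c * indicator B z)" using B B_fin by auto
    define g where "g z = f z - c * indicator B z" for z
    have g: "integrable M g" unfolding g_def using f ind by auto
    define A where "A = {z \<in> space M. \<exists>n\<le>N. 0 < (\<Sum>k<n. g ((T ^^ k) z))}"
    have [measurable]: "g \<in> borel_measurable M" using g by auto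
    have A[measurable]: "A \<in> sets M" unfolding A_def by measurable
    \<comment> \<open>Since the indicator is at most 1, subtracting it lowers a sum of
      \<open>n\<close> terms by at most \<open>c * n\<close>, so an exceedance for \<open>f\<close>
      leaves a positive sum for \<open>g\<close>.\<close>
    have sub: "B \<subseteq> A"
    proof
      fix z assume "z \<in> B"
      then obtain n where n: "n \<le> N" "c * real n < (\<Sum>k<n. f ((T ^^ k) z))" "z \<in> space M"
        by (auto simp: B_def E_def)
      have "(\<Sum>k<n. f ((T ^^ k) z)) - c * real n = (\<Sum>k<n. f ((T ^^ k) z) - c)"
        by (simp add: sum_subtractf)
      also have "\<dots> \<le> (\<Sum>k<n. g ((T ^^ k) z))"
        unfolding g_def using c by (intro sum_mono) (auto simp: indicator_def)
      finally show "z \<in> A" using n by (auto simp: A_def)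
    qed
    have "0 \<le> (\<integral>z. indicator A z * g z \<partial>M)"
      unfolding A_def by (rule Garsia[OF T inv g])
    \<comment> \<open>Off \<open>A\<close> the left integrand is 0 and, as
      \<open>B \<subseteq> A\<close>, the right one is \<open>\<bar>f z\<bar>\<close>.\<close>
    also have "\<dots> \<le> (\<integral>z. \<bar>f z\<bar> - c * indicator B z \<partial>M)"
      using integrable_mult_indicator[OF A g] f ind sub c
      by (intro integral_mono) (auto simp: g_def indicator_def)
    also have "\<dots> = (\<integral>z. \<bar>f z\<bar> \<partial>M) - c * measure M B"
      using f ind by simp
    finally have "c * measure M B \<le> (\<integral>z. \<bar>f z\<bar> \<partial>M)" by simp
    then have "measure M B \<le> (\<integral>z. \<bar>f z\<bar> \<partial>M) / c" using c by (simp add: field_simps)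
    then have "ennreal (measure M B) \<le> ennreal ((\<integral>z. \<bar>f z\<bar> \<partial>M) / c)" by (rule ennreal_leI)
    then show ?thesis
      using B_fin c by (simp add: B_def emeasure_eq_ennreal_measure less_top divide_ennreal)
  qed
  have inc: "incseq (\<lambda>N. E N \<inter> W N)"
    using W(4) unfolding incseq_def E_def by (blast intro: order_trans)
  have "{z \<in> space M. \<exists>n. c * real n < (\<Sum>k<n. f ((T ^^ k) z))} = (\<Union>N. E N \<inter> W N)" (is "?L = ?R")
  proof
    show "?L \<subseteq> ?R"
    proof
      fix z assume z: "z \<in> ?L"
      then obtain n where n: "z \<in> E n" by (auto simp: E_def)
      obtain i where i: "z \<in> W i" using z W(2) by auto
      \<comment> \<open>Both families increase with the index, so a common index serves for the time
        bound and for the exhausting set.\<close>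
      have "z \<in> E (max n i)" using n by (auto simp: E_def le_max_iff_disj)
      moreover have "z \<in> W (max n i)" using i incseqD[OF W(4), of i "max n i"] by auto
      ultimately show "z \<in> ?R" by blast
    qed
  qed (auto simp: E_def)
  moreover have "(SUP N. emeasure M (E N \<inter> W N)) = emeasure M (\<Union>N. E N \<inter> W N)"
    using inc by (intro SUP_emeasure_incseq) auto
  moreover have "(SUP N. emeasure M (E N \<inter> W N)) \<le> ennreal (\<integral>z. \<bar>f z\<bar> \<partial>M) / ennreal c"
    using bound by (rule SUP_least)
  ultimately show ?thesis by simp
qed

subsection \<open>Measurability of the flow\<close>

lemma ball_in_sets_borel [measurable]: "ball c r \<in> sets borel"
  by simp

lemma space_Omega0_M: "space Omega0_M = (Omega0 :: (real \<Rightarrow> 'a::euclidean_space) set)"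
  by (simp add: Omega0_M_def space_restrict_space space_PiM)

lemma measurable_Omega0_eval:
  "(\<lambda>\<omega>. \<omega> t) \<in> borel_measurable (Omega0_M :: (real \<Rightarrow> 'a::euclidean_space) measure)"
  unfolding Omega0_M_def by (intro measurable_restrict_space1 measurable_component_singleton) simp

text \<open>Cylinder measurability concerns one time at a time. Continuity of paths gives joint
  measurability: rounding the time down to a grid of mesh \<open>1 / Suc n\<close> yields a
  countable pasting of single evaluations, and these converge pointwise as the mesh shrinks.\<close>

lemma measurable_Omega0_joint_eval:
  "(\<lambda>p. fst p (snd p)) \<in> borel_measurable ((Omega0_M :: (real \<Rightarrow> 'a::euclidean_space) measure) \<Otimes>\<^sub>M borel)"
proof (rule borel_measurable_LIMSEQ_metric)
  fix n :: nat
  have "(\<lambda>p::(real \<Rightarrow> 'a) \<times> real. fst p (real_of_int i / real (Suc n)))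
      \<in> borel_measurable (Omega0_M \<Otimes>\<^sub>M borel)" for i
    by (rule measurable_compose[OF measurable_fst measurable_Omega0_eval])
  moreover have "(\<lambda>p::(real \<Rightarrow> 'a) \<times> real. \<lfloor>real (Suc n) * snd p\<rfloor>) \<in> measurable (Omega0_M \<Otimes>\<^sub>M borel) (count_space UNIV)"
    by measurable
  ultimately show "(\<lambda>p::(real \<Rightarrow> 'a) \<times> real. fst p (real_of_int \<lfloor>real (Suc n) * snd p\<rfloor> / real (Suc n)))
      \<in> borel_measurable (Omega0_M \<Otimes>\<^sub>M borel)"
    by (rule measurable_compose_countable)
next
  fix p :: "(real \<Rightarrow> 'a) \<times> real" assume "p \<in> space (Omega0_M \<Otimes>\<^sub>M borel)"
  then have cont: "continuous_on UNIV (fst p)"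
    by (auto simp: space_pair_measure space_Omega0_M Omega0_def)
  have "(\<lambda>n. real_of_int \<lfloor>real (Suc n) * snd p\<rfloor> / real (Suc n)) \<longlonglongrightarrow> snd p"
  proof (rule tendsto_sandwich)
    show "\<forall>\<^sub>F n in sequentially. snd p - 1 / real (Suc n) \<le> real_of_int \<lfloor>real (Suc n) * snd p\<rfloor> / real (Suc n)"
    proof (rule always_eventually, rule allI)
      fix n
      have "real (Suc n) * snd p - 1 \<le> real_of_int \<lfloor>real (Suc n) * snd p\<rfloor>" by linarith
      from divide_right_mono[OF this, of "real (Suc n)"]
      show "snd p - 1 / real (Suc n) \<le> real_of_int \<lfloor>real (Suc n) * snd p\<rfloor> / real (Suc n)"
        by (simp add: diff_divide_distrib del: of_nat_Suc)
    qed
    show "\<forall>\<^sub>F n in sequentially. real_of_int \<lfloor>real (Suc n) * snd p\<rfloor> / real (Suc n) \<le> snd p"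
    proof (rule always_eventually, rule allI)
      fix n
      have "real_of_int \<lfloor>real (Suc n) * snd p\<rfloor> \<le> real (Suc n) * snd p" by linarith
      from divide_right_mono[OF this, of "real (Suc n)"] show "real_of_int \<lfloor>real (Suc n) * snd p\<rfloor> / real (Suc n) \<le> snd p"
        by (simp del: of_nat_Suc)
    qed
    show "(\<lambda>n. snd p - 1 / real (Suc n)) \<longlonglongrightarrow> snd p"
      using tendsto_diff[OF tendsto_const[of "snd p"] LIMSEQ_Suc[OF lim_1_over_n]] by simp
  qed simp
  then show "(\<lambda>n. fst p (real_of_int \<lfloor>real (Suc n) * snd p\<rfloor> / real (Suc n))) \<longlonglongrightarrow> fst p (snd p)"
    using cont by (auto intro: isCont_tendsto_compose simp: continuous_on_eq_continuous_at)
qed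

lemma measurable_eval_compose:
  assumes "f \<in> measurable M (Omega0_M :: (real \<Rightarrow> 'a::euclidean_space) measure)" "g \<in> borel_measurable M"
  shows "(\<lambda>x. f x (g x)) \<in> borel_measurable M"
  using measurable_compose[OF measurable_Pair[OF assms] measurable_Omega0_joint_eval] by simp

lemma shift_in_Omega0: "\<omega> \<in> Omega0 \<Longrightarrow> shift t \<omega> \<in> Omega0"
  unfolding Omega0_def shift_def by (auto intro!: continuous_intros continuous_on_compose2[of UNIV \<omega>])

lemma measurable_shift [measurable]:
  "shift t \<in> measurable Omega0_M (Omega0_M :: (real \<Rightarrow> 'a::euclidean_space) measure)"
  unfolding Omega0_M_def
proof (rule measurable_restrict_space2)
  show "shift t \<in> space (restrict_space (PiM UNIV (\<lambda>_. borel)) Omega0) \<rightarrow> Omega0"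
    using shift_in_Omega0 by (auto simp: space_restrict_space)
  show "shift t \<in> measurable (restrict_space (PiM UNIV (\<lambda>_. borel)) Omega0) (PiM UNIV (\<lambda>_. borel))"
    unfolding Omega0_M_def[symmetric] shift_def[abs_def]
    by (rule measurable_PiM_single')
      (auto simp: space_PiM intro: borel_measurable_diff[OF measurable_Omega0_eval measurable_Omega0_eval])
qed

lemma measurable_shift_pair [measurable]:
  "shift_pair t \<in> measurable (Omega0_M \<Otimes>\<^sub>M borel)
     (Omega0_M \<Otimes>\<^sub>M (borel :: 'a::euclidean_space measure))"
proof -
  have [measurable]: "(\<lambda>p. fst p t) \<in> borel_measurable (Omega0_M \<Otimes>\<^sub>M (borel :: 'a measure))"
    by (rule measurable_eval_compose) measurable
  show ?thesis unfolding shift_pair_def[abs_def] by measurable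
qed

lemma shift_pair_0: "fst p \<in> Omega0 \<Longrightarrow> shift_pair 0 p = p"
  by (cases p) (auto simp: shift_pair_def shift_def Omega0_def)

lemma shift_pair_shift_pair: "shift_pair s (shift_pair t p) = shift_pair (s + t) p"
  by (auto simp: shift_pair_def shift_def algebra_simps)

subsection \<open>Occupation times\<close>

definition visits :: "real \<Rightarrow> (real \<Rightarrow> 'a::euclidean_space) \<times> 'a \<Rightarrow> real set" where
  "visits R p = {t. norm (snd p + fst p t) < R}"

text \<open>Integer horizons and half-open windows make this a Birkhoff sum of
  \<open>occ R 1\<close> under the time-one map, with no overlap between consecutive
  windows.\<close>

definition occ :: "real \<Rightarrow> nat \<Rightarrow> (real \<Rightarrow> 'a::euclidean_space) \<times> 'a \<Rightarrow> real" where
  "occ R n p = measure lborel ({0..<real n} \<inter> visits R p)"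

text \<open>Taking the limsup gives a quantity defined for every path, so no convergence theorem is
  needed. The term at \<open>n = 0\<close> is \<open>0 / 0 = 0\<close> and does not affect the
  limsup.\<close>

definition upper_density :: "real \<Rightarrow> (real \<Rightarrow> 'a::euclidean_space) \<times> 'a \<Rightarrow> ereal" where
  "upper_density R p = limsup (\<lambda>n. ereal (occ R n p / real n))"

lemma visits_borel: "fst p \<in> Omega0 \<Longrightarrow> visits R p \<in> sets borel"
  unfolding visits_def Omega0_def
  by (intro borel_open open_Collect_less continuous_intros) auto

text \<open>The new starting point \<open>x + \<omega> s\<close> cancels the subtraction of
  \<open>\<omega> s\<close> in the shifted path, so the same trajectory is seen with its clock moved
  by \<open>s\<close>.\<close>

lemma visits_shift_pair: "visits R (shift_pair s p) = (\<lambda>t. s + t) -` visits R p"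
  by (auto simp: visits_def shift_pair_def shift_def algebra_simps)

lemma measure_lborel_translate:
  fixes a b s :: real
  assumes [measurable]: "E \<in> sets borel"
  shows "measure lborel ({a..<b} \<inter> (\<lambda>t. s + t) -` E) = measure lborel ({s + a..<s + b} \<inter> E)"
proof -
  have "{s + a..<s + b} \<inter> E \<in> sets borel" by measurable
  have "measure lborel ({s + a..<s + b} \<inter> E) = measure (distr lborel borel ((+) s)) ({s + a..<s + b} \<inter> E)"
    by (simp add: lborel_distr_plus)
  also have "\<dots> = measure lborel ((+) s -` ({s + a..<s + b} \<inter> E) \<inter> space lborel)"
    using \<open>{s + a..<s + b} \<inter> E \<in> sets borel\<close> by (subst measure_distr) auto
  also have "(+) s -` ({s + a..<s + b} \<inter> E) \<inter> space lborel = {a..<b} \<inter> (\<lambda>t. s + t) -` E" by auto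
  finally show ?thesis by simp
qed

lemma fmeasurable_interval_Int:
  assumes "E \<in> sets borel"
  shows "{a..<b::real} \<inter> E \<in> fmeasurable lborel"
proof -
  have "{a..<b::real} \<in> fmeasurable lborel"
    by (cases "a \<le> b") (auto intro!: fmeasurableI)
  then show ?thesis using assms by (intro fmeasurable_Int_fmeasurable) auto
qed

lemma occ_nonneg: "0 \<le> occ R n p"
  by (simp add: occ_def)

lemma occ_shift_pair:
  assumes "fst p \<in> Omega0"
  shows "occ R n (shift_pair s p) = measure lborel ({s..<s + real n} \<inter> visits R p)"
  unfolding occ_def visits_shift_pair
  using measure_lborel_translate[OF visits_borel[OF assms], of 0 "real n" s] by simp

text \<open>The moved window leaves the original one only through two end pieces, each of length at
  most \<open>\<bar>s\<bar>\<close>.\<close>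

lemma occ_shift_pair_le:
  assumes "fst p \<in> Omega0"
  shows "occ R n (shift_pair s p) \<le> occ R n p + 2 * \<bar>s\<bar>"
proof -
  have [measurable]: "visits R p \<in> sets borel" by (rule visits_borel[OF assms])
  have f: "{a..<b::real} \<in> fmeasurable lborel" for a b
    using fmeasurable_interval_Int[of UNIV a b] by simp
  have fv: "{0..<real n} \<inter> visits R p \<in> fmeasurable lborel"
    by (rule fmeasurable_interval_Int) measurable
  have "measure lborel ({s..<s + real n} \<inter> visits R p)
    \<le> measure lborel ((({0..<real n} \<inter> visits R p) \<union> {-\<bar>s\<bar>..<0}) \<union> {real n..<real n + \<bar>s\<bar>})"
    using f fv by (intro measure_mono_fmeasurable fmeasurable.Un) auto
  also have "\<dots> \<le> measure lborel (({0..<real n} \<inter> visits R p) \<union> {-\<bar>s\<bar>..<0}) + measure lborel {real n..<real n + \<bar>s\<bar>}"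
    by (intro measure_Un_le) auto
  also have "\<dots> \<le> (occ R n p + measure lborel {-\<bar>s\<bar>..<0}) + measure lborel {real n..<real n + \<bar>s\<bar>}"
    unfolding occ_def by (intro add_mono measure_Un_le order_refl) auto
  finally show ?thesis by (simp add: occ_shift_pair[OF assms])
qed

lemma fst_shift_pair_in_Omega0: "fst p \<in> Omega0 \<Longrightarrow> fst (shift_pair s p) \<in> Omega0"
  by (simp add: shift_pair_def shift_in_Omega0)

lemma occ_shift_pair_diff:
  assumes "fst p \<in> Omega0"
  shows "\<bar>occ R n (shift_pair s p) - occ R n p\<bar> \<le> 2 * \<bar>s\<bar>"
proof -
  \<comment> \<open>The opposite inequality is the previous bound at the shifted point, moved back
    by \<open>- s\<close>.\<close>
  have "occ R n p = occ R n (shift_pair (- s) (shift_pair s p))"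
    by (simp add: shift_pair_shift_pair shift_pair_0 assms)
  also have "\<dots> \<le> occ R n (shift_pair s p) + 2 * \<bar>s\<bar>"
    using occ_shift_pair_le[OF fst_shift_pair_in_Omega0[OF assms], of R n "- s" s] by simp
  finally show ?thesis using occ_shift_pair_le[OF assms, of R n s] by simp
qed

text \<open>The occupation times differ by an amount bounded in \<open>n\<close>, which disappears
  after division by \<open>n\<close>. The equality holds for every continuous path and every real
  \<open>s\<close>, not just almost everywhere, as strict invariance of the level sets
  demands.\<close>

lemma upper_density_shift_pair:
  assumes "fst p \<in> Omega0"
  shows "upper_density R (shift_pair s p) = upper_density R p"
proof -
  define d where "d n = (occ R n (shift_pair s p) - occ R n p) / real n" for n
  have "(\<lambda>n. 2 * \<bar>s\<bar> / real n) \<longlonglongrightarrow> 0" by (rule lim_const_over_n)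
  then have "d \<longlonglongrightarrow> 0"
    by (rule Lim_null_comparison[rotated])
      (use occ_shift_pair_diff[OF assms, of R _ s] in \<open>auto intro!: divide_right_mono always_eventually simp: d_def\<close>)
  then have "(\<lambda>n. ereal (d n)) \<longlonglongrightarrow> 0" by (simp add: zero_ereal_def)
  then have "limsup (\<lambda>n. ereal (d n) + ereal (occ R n p / real n)) = 0 + upper_density R p"
    unfolding upper_density_def by (rule ereal_limsup_lim_add) simp
  then show ?thesis
    by (simp add: upper_density_def d_def diff_divide_distrib)
qed

lemma shift_pair_funpow: "fst p \<in> Omega0 \<Longrightarrow> (shift_pair 1 ^^ k) p = shift_pair (real k) p"
  by (induction k) (auto simp: shift_pair_0 shift_pair_shift_pair)

text \<open>This identity turns occupation times into the ergodic sums to which the maximal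
  inequality applies.\<close>

lemma sum_occ:
  assumes "fst p \<in> Omega0"
  shows "(\<Sum>k<n. occ R 1 ((shift_pair 1 ^^ k) p)) = occ R n p"
proof (induction n)
  case 0 show ?case by (simp add: occ_def)
next
  case (Suc n)
  have v: "visits R p \<in> sets borel" by (rule visits_borel[OF assms])
  have "occ R (Suc n) p = measure lborel (({0..<real n} \<inter> visits R p) \<union> ({real n..<real n + 1} \<inter> visits R p))"
    unfolding occ_def by (intro arg_cong[where f = "measure lborel"]) auto
  also have "\<dots> = occ R n p + occ R 1 ((shift_pair 1 ^^ n) p)"
    unfolding shift_pair_funpow[OF assms] occ_shift_pair[OF assms]
    using fmeasurable_interval_Int[OF v, of 0 "real n"] fmeasurable_interval_Int[OF v, of "real n" "real n + 1"]
    unfolding occ_def by (subst measure_Union) (auto simp: fmeasurable_def)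
  finally show ?case using Suc by simp
qed

text \<open>The integral form gives measurability in \<open>p\<close> and allows the order of
  integration to be exchanged.\<close>

lemma ennreal_occ:
  assumes "fst p \<in> Omega0"
  shows "ennreal (occ R n p)
    = (\<integral>\<^sup>+t. indicator {0..<real n} t * indicator (ball 0 R) (snd p + fst p t) \<partial>lborel)"
proof -
  have v: "visits R p \<in> sets borel" by (rule visits_borel[OF assms])
  have "ennreal (occ R n p) = emeasure lborel ({0..<real n} \<inter> visits R p)"
    unfolding occ_def using fmeasurable_interval_Int[OF v, of 0 "real n"]
    by (subst emeasure_eq_ennreal_measure) (auto simp: fmeasurable_def less_top)
  also have "\<dots> = (\<integral>\<^sup>+t. indicator ({0..<real n} \<inter> visits R p) t \<partial>lborel)"
    using v by (subst nn_integral_indicator) auto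
  also have "\<dots> = (\<integral>\<^sup>+t. indicator {0..<real n} t * indicator (ball 0 R) (snd p + fst p t) \<partial>lborel)"
    by (intro nn_integral_cong) (auto simp: indicator_def visits_def)
  finally show ?thesis .
qed

lemma measurable_occ [measurable]:
  "occ R n \<in> borel_measurable (Omega0_M \<Otimes>\<^sub>M (borel :: 'a::euclidean_space measure))"
proof -
  have [measurable]: "(\<lambda>z. fst (fst z) (snd z))
      \<in> borel_measurable ((Omega0_M \<Otimes>\<^sub>M (borel :: 'a measure)) \<Otimes>\<^sub>M borel)"
    by (rule measurable_eval_compose) measurable
  have "(\<lambda>p. \<integral>\<^sup>+t. indicator {0..<real n} t * indicator (ball 0 R) (snd p + fst p t) \<partial>lborel)
      \<in> borel_measurable (Omega0_M \<Otimes>\<^sub>M (borel :: 'a measure))"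
    by measurable
  then have "(\<lambda>p. enn2real (\<integral>\<^sup>+t. indicator {0..<real n} t * indicator (ball 0 R) (snd p + fst p t) \<partial>lborel))
      \<in> borel_measurable (Omega0_M \<Otimes>\<^sub>M (borel :: 'a measure))"
    by measurable
  moreover have "occ R n p = enn2real (\<integral>\<^sup>+t. indicator {0..<real n} t * indicator (ball 0 R) (snd p + fst p t) \<partial>lborel)"
    if "p \<in> space (Omega0_M \<Otimes>\<^sub>M (borel :: 'a measure))" for p
  proof -
    have "fst p \<in> Omega0" using that by (auto simp: space_pair_measure space_Omega0_M)
    from arg_cong[OF ennreal_occ[OF this, of R n], of enn2real] show ?thesis by (simp add: occ_nonneg)
  qed
  ultimately show ?thesis by (simp cong: measurable_cong)
qed

lemma measurable_upper_density [measurable]: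
  "upper_density R \<in> borel_measurable (Omega0_M \<Otimes>\<^sub>M (borel :: 'a::euclidean_space measure))"
  unfolding upper_density_def[abs_def] by measurable

text \<open>Moving the starting point from \<open>x\<close> to \<open>y\<close> changes distances to
  the origin by at most \<open>norm (x - y)\<close>, which the larger ball absorbs.\<close>

lemma occ_mono:
  assumes "\<omega> \<in> Omega0" "norm (x - y) + R \<le> R'"
  shows "occ R n (\<omega>, x) \<le> occ R' n (\<omega>, y)"
proof -
  have "visits R (\<omega>, x) \<subseteq> visits R' (\<omega>, y)"
  proof
    fix t assume "t \<in> visits R (\<omega>, x)"
    moreover have "norm (y + \<omega> t) \<le> norm (x + \<omega> t) + norm (x - y)"
      by (rule norm_triangle_sub[of "y + \<omega> t" "x + \<omega> t", simplified, unfolded norm_minus_commute[of y]])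
    ultimately show "t \<in> visits R' (\<omega>, y)" using assms(2) by (simp add: visits_def)
  qed
  then show ?thesis
    unfolding occ_def using assms(1)
    by (intro measure_mono_fmeasurable fmeasurable_interval_Int) (auto intro!: visits_borel sets.Int)
qed

lemma upper_density_mono:
  assumes "\<omega> \<in> Omega0" "norm (x - y) + R \<le> R'"
  shows "upper_density R (\<omega>, x) \<le> upper_density R' (\<omega>, y)"
  unfolding upper_density_def
  using occ_mono[OF assms] by (intro Limsup_mono always_eventually) (auto intro!: divide_right_mono)

lemma occ_tendsto_0:
  assumes "\<not> 0 < upper_density R p"
  shows "(\<lambda>n. occ R n p / real n) \<longlonglongrightarrow> 0"
proof (rule limsup_le_liminf_real)
  show "limsup (\<lambda>n. ereal (occ R n p / real n)) \<le> ereal 0"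
    using assms by (simp add: upper_density_def zero_ereal_def not_less)
  show "ereal 0 \<le> liminf (\<lambda>n. ereal (occ R n p / real n))"
    by (intro Liminf_bounded always_eventually) (simp add: occ_nonneg)
qed

subsection \<open>Abel means\<close>

text \<open>The Abel weights \<open>\<epsilon> * exp (- \<epsilon> * t)\<close> on the half-line
  form the exponential law, so Abel means become expectations under a probability measure.\<close>

definition expo :: "real \<Rightarrow> real measure" where
  "expo \<epsilon> = density lborel (exponential_density \<epsilon>)"

lemma sets_expo [simp, measurable_cong]: "sets (expo \<epsilon>) = sets borel"
  by (simp add: expo_def)

lemma space_expo [simp]: "space (expo \<epsilon>) = UNIV"
  by (simp add: expo_def)

lemma prob_space_expo: "0 < \<epsilon> \<Longrightarrow> prob_space (expo \<epsilon>)"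
  unfolding expo_def by (rule prob_space_exponential_density)

lemma Abel_mean_eq_expo:
  assumes "0 < \<epsilon>" and [measurable]: "g \<in> borel_measurable borel"
  shows "\<epsilon> * (LBINT t:{0..}. exp (- \<epsilon> * t) * g t) = (\<integral>t. g t \<partial>expo \<epsilon>)"
proof -
  have "(\<integral>t. g t \<partial>expo \<epsilon>) = (\<integral>t. exponential_density \<epsilon> t *\<^sub>R g t \<partial>lborel)"
    unfolding expo_def using assms by (intro integral_density) (auto simp: exponential_density_nonneg)
  also have "\<dots> = (\<integral>t. \<epsilon> * (indicator {0..} t *\<^sub>R (exp (- \<epsilon> * t) * g t)) \<partial>lborel)"
    by (intro Bochner_Integration.integral_cong) (auto simp: exponential_density_def indicator_def mult.commute)
  also have "\<dots> = \<epsilon> * (\<integral>t. indicator {0..} t *\<^sub>R (exp (- \<epsilon> * t) * g t) \<partial>lborel)"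
    by (rule integral_mult_right_zero)
  finally show ?thesis by (simp add: set_lebesgue_integral_def)
qed

text \<open>Before time \<open>n\<close> the exponential density is at most
  \<open>\<epsilon>\<close>; beyond it the total mass is
  \<open>exp (- (\<epsilon> * n))\<close>.\<close>

lemma expo_measure_le:
  assumes \<epsilon>: "0 < \<epsilon>" and [measurable]: "E \<in> sets borel"
  shows "measure (expo \<epsilon>) E \<le> \<epsilon> * measure lborel ({0..<real n} \<inter> E) + exp (- (\<epsilon> * real n))"
proof -
  interpret prob_space "expo \<epsilon>" by (rule prob_space_expo[OF \<epsilon>])
  have "measure (expo \<epsilon>) {real n<..} = exp (- real n * \<epsilon>)"
  proof -
    have "distributed (expo \<epsilon>) lborel (\<lambda>t. t) (exponential_density \<epsilon>)"
      unfolding distributed_def using \<epsilon>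
      by (auto simp: expo_def exponential_density_nonneg intro!: distr_id2)
    from exponential_distributedD_gt[OF this, of "real n"] \<epsilon> show ?thesis
      by (simp add: greaterThan_def)
  qed
  moreover have "measure (expo \<epsilon>) ({0..<real n} \<inter> E) \<le> \<epsilon> * measure lborel ({0..<real n} \<inter> E)"
  proof -
    have fin: "emeasure lborel ({0..<real n} \<inter> E) < \<infinity>"
      using fmeasurable_interval_Int[of E 0 "real n"] by (auto simp: fmeasurable_def)
    have "emeasure (expo \<epsilon>) ({0..<real n} \<inter> E)
        = (\<integral>\<^sup>+t. ennreal (exponential_density \<epsilon> t) * indicator ({0..<real n} \<inter> E) t \<partial>lborel)"
      unfolding expo_def by (subst emeasure_density) (auto intro: sets.Int)
    also have "\<dots> \<le> (\<integral>\<^sup>+t. ennreal \<epsilon> * indicator ({0..<real n} \<inter> E) t \<partial>lborel)"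
      using \<epsilon> by (intro nn_integral_mono mult_right_mono ennreal_leI) (auto simp: exponential_density_def)
    also have "\<dots> = ennreal \<epsilon> * emeasure lborel ({0..<real n} \<inter> E)"
      by (subst nn_integral_cmult_indicator) (auto intro: sets.Int)
    also have "\<dots> = ennreal (\<epsilon> * measure lborel ({0..<real n} \<inter> E))"
      using fin \<epsilon> by (simp add: emeasure_eq_ennreal_measure less_top ennreal_mult)
    finally show ?thesis
      using \<epsilon> by (simp add: emeasure_eq_measure)
  qed
  moreover have "measure (expo \<epsilon>) E
      = measure (expo \<epsilon>) (E \<inter> {0..})"
  proof -
    have "AE t in expo \<epsilon>. 0 \<le> t"
      unfolding expo_def by (subst AE_density) (auto simp: exponential_density_def)
    then have "AE t in expo \<epsilon>. t \<in> E \<longleftrightarrow> t \<in> E \<inter> {0..}" by eventually_elim auto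
    then show ?thesis by (rule finite_measure_eq_AE) auto
  qed
  moreover have "measure (expo \<epsilon>) (E \<inter> {0..}) \<le> measure (expo \<epsilon>) (({0..<real n} \<inter> E) \<union> {real n} \<union> {real n<..})"
    by (intro finite_measure_mono) (auto intro!: sets.Un sets.Int)
  moreover have "\<dots> \<le> measure (expo \<epsilon>) (({0..<real n} \<inter> E) \<union> {real n}) + measure (expo \<epsilon>) {real n<..}"
    by (intro measure_Un_le) (auto intro!: sets.Un sets.Int)
  moreover have "measure (expo \<epsilon>) (({0..<real n} \<inter> E) \<union> {real n}) \<le> measure (expo \<epsilon>) ({0..<real n} \<inter> E) + measure (expo \<epsilon>) {real n}"
    by (intro measure_Un_le) (auto intro!: sets.Un sets.Int)
  \<comment> \<open>The point \<open>n\<close> lies neither in the half-open window nor in the open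
    tail and has to be discarded separately.\<close>
  moreover have "measure (expo \<epsilon>) {real n} = 0"
  proof -
    have "AE t in lborel. t \<in> {real n} \<longrightarrow> ennreal (exponential_density \<epsilon> t) = 0"
      using AE_lborel_singleton[of "real n"] by eventually_elim simp
    then have "{real n} \<in> null_sets (expo \<epsilon>)"
      unfolding expo_def by (subst null_sets_density_iff) auto
    then show ?thesis by (simp add: measure_eq_0_null_sets)
  qed
  ultimately show ?thesis by (simp add: mult.commute)
qed

text \<open>Vanishing Cesaro density implies vanishing Abel density: the window is cut at a time of
  order \<open>K / \<epsilon>\<close>, with \<open>K\<close> so large that the tail is
  negligible.\<close>

lemma expo_measure_tendsto_0:
  assumes E[measurable]: "E \<in> sets borel"
    and lim: "(\<lambda>n. measure lborel ({0..<real n} \<inter> E) / real n) \<longlonglongrightarrow> 0"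
  shows "((\<lambda>\<epsilon>. measure (expo \<epsilon>) E) \<longlongrightarrow> 0) (at_right 0)"
proof (rule tendstoI)
  fix \<delta> :: real assume \<delta>: "0 < \<delta>"
  have "((\<lambda>K. exp (- K)) \<longlongrightarrow> (0::real)) at_top"
    by (rule filterlim_compose[OF exp_at_bot filterlim_uminus_at_bot_at_top])
  from order_tendstoD(2)[OF this, of "\<delta> / 2"] \<delta>
  have "eventually (\<lambda>K. 1 \<le> K \<and> exp (- K) < \<delta> / 2) at_top"
    by (intro eventually_conj eventually_ge_at_top) simp
  then obtain K :: real where K: "1 \<le> K" "exp (- K) < \<delta> / 2"
    by (auto simp: eventually_at_top_linorder)
  \<comment> \<open>The threshold anticipates \<open>\<epsilon> * n \<le> 2 * K\<close>, so that the
    window contributes at most \<open>\<delta> / 2\<close>.\<close>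
  have "eventually (\<lambda>n. measure lborel ({0..<real n} \<inter> E) / real n < \<delta> / (4 * K)) sequentially"
    using \<delta> K by (intro order_tendstoD(2)[OF lim]) auto
  then obtain N where N: "\<And>n. n \<ge> N \<Longrightarrow> measure lborel ({0..<real n} \<inter> E) / real n < \<delta> / (4 * K)"
    by (auto simp: eventually_sequentially)
  \<comment> \<open>The bound on \<open>\<epsilon>\<close> serves twice: it forces the cut
    \<open>n\<close> past \<open>N\<close>, and it gives \<open>\<epsilon> < 1 \<le> K\<close>,
    hence \<open>K + \<epsilon> \<le> 2 * K\<close>.\<close>
  have "dist (measure (expo \<epsilon>) E) 0 < \<delta>" if \<epsilon>: "0 < \<epsilon>" "\<epsilon> < 1 / (real N + 1)" for \<epsilon>
  proof -
    define n where "n = nat \<lceil>K / \<epsilon>\<rceil>"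
    have K\<epsilon>: "0 < K / \<epsilon>" using K \<epsilon> by simp
    have n1: "K / \<epsilon> \<le> real n" unfolding n_def by linarith
    have n2: "real n \<le> K / \<epsilon> + 1" unfolding n_def using K\<epsilon> by linarith
    have n3: "K \<le> \<epsilon> * real n" using n1 \<epsilon> by (simp add: field_simps)
    have "\<epsilon> * real n \<le> \<epsilon> * (K / \<epsilon> + 1)" using n2 \<epsilon> by (intro mult_left_mono) auto
    also have "\<dots> = K + \<epsilon>" using \<epsilon> by (simp add: field_simps)
    also have "\<dots> \<le> 2 * K"
    proof -
      have "1 / (real N + 1) \<le> 1" by simp
      then show ?thesis using \<epsilon> K by linarith
    qed
    finally have n4: "\<epsilon> * real n \<le> 2 * K" .
    have npos: "0 < real n" using n1 K\<epsilon> by linarith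
    have "real N + 1 < 1 / \<epsilon>" using \<epsilon> by (simp add: field_simps)
    also have "\<dots> \<le> K / \<epsilon>" using K \<epsilon> by (intro divide_right_mono) auto
    finally have "N \<le> n" using n1 by linarith
    from N[OF this] have 1: "measure lborel ({0..<real n} \<inter> E) \<le> real n * (\<delta> / (4 * K))"
      using npos by (simp add: divide_less_eq mult.commute)
    have "measure (expo \<epsilon>) E \<le> \<epsilon> * measure lborel ({0..<real n} \<inter> E) + exp (- (\<epsilon> * real n))"
      using \<epsilon> by (intro expo_measure_le) auto
    also have "\<dots> \<le> \<epsilon> * (real n * (\<delta> / (4 * K))) + exp (- K)"
      using 1 \<epsilon> n3 by (intro add_mono mult_left_mono) auto
    also have "\<dots> = (\<epsilon> * real n) * (\<delta> / (4 * K)) + exp (- K)" by simp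
    also have "\<dots> \<le> (2 * K) * (\<delta> / (4 * K)) + exp (- K)"
      using n4 \<delta> K by (intro add_mono mult_right_mono) auto
    also have "\<dots> = \<delta> / 2 + exp (- K)" using K by simp
    also have "\<dots> < \<delta>" using K by simp
    finally show ?thesis by simp
  qed
  then show "eventually (\<lambda>\<epsilon>. dist (measure (expo \<epsilon>) E) 0 < \<delta>) (at_right 0)"
    unfolding eventually_at_right_field
    by (intro exI[of _ "1 / (real N + 1)"]) auto
qed

lemma vanishing_bounded:
  fixes V :: "'a::euclidean_space \<Rightarrow> real"
  assumes "continuous_on UNIV V" "((\<lambda>x. \<bar>V x\<bar>) \<longlongrightarrow> 0) at_infinity"
  obtains C where "0 < C" "\<And>x. \<bar>V x\<bar> \<le> C"
proof -
  have "eventually (\<lambda>x. \<bar>V x\<bar> < 1) at_infinity"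
    using assms(2) by (rule order_tendstoD) simp
  then obtain b where b: "\<And>x. b \<le> norm x \<Longrightarrow> \<bar>V x\<bar> < 1"
    by (auto simp: eventually_at_infinity)
  have "bounded (V ` cball 0 b)"
    using assms(1) by (intro compact_imp_bounded compact_continuous_image) (auto intro: continuous_on_subset)
  then obtain C where "\<forall>y\<in>V ` cball 0 b. norm y \<le> C" unfolding bounded_iff by blast
  then have C: "\<bar>V x\<bar> \<le> C" if "x \<in> cball 0 b" for x using that by simp
  have "\<bar>V x\<bar> \<le> max C 1" for x
    using C[of x] b[of x] by (cases "norm x \<le> b") auto
  then show ?thesis by (intro that[of "max C 1"]) auto
qed

text \<open>Outside a large ball \<open>V\<close> is small, and inside it \<open>V\<close> is
  bounded while the exponential law gives vanishing weight to the times spent there.\<close>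

lemma expo_mean_tendsto_0:
  fixes V :: "'a::euclidean_space \<Rightarrow> real"
  assumes \<omega>: "\<omega> \<in> Omega0" and V: "continuous_on UNIV V" "((\<lambda>x. \<bar>V x\<bar>) \<longlongrightarrow> 0) at_infinity"
    and null: "\<And>N::nat. \<not> 0 < upper_density (real N) (\<omega>, 0)"
  shows "((\<lambda>\<epsilon>. \<integral>t. V (\<omega> t) \<partial>expo \<epsilon>) \<longlongrightarrow> 0) (at_right 0)"
proof (rule tendstoI)
  fix \<delta> :: real assume \<delta>: "0 < \<delta>"
  obtain C where C: "0 < C" "\<And>x. \<bar>V x\<bar> \<le> C" using vanishing_bounded[OF V] by blast
  have [measurable]: "\<omega> \<in> borel_measurable borel" "V \<in> borel_measurable borel"
    using \<omega> V by (auto simp: Omega0_def intro: borel_measurable_continuous_onI)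
  have "eventually (\<lambda>x. \<bar>V x\<bar> < \<delta> / 2) at_infinity"
    using V(2) by (rule order_tendstoD) (use \<delta> in simp)
  then obtain b where b: "\<And>x. b \<le> norm x \<Longrightarrow> \<bar>V x\<bar> < \<delta> / 2"
    by (auto simp: eventually_at_infinity)
  obtain N :: nat where N: "b \<le> real N" using real_arch_simple by blast
  define E where "E = visits (real N) (\<omega>, 0)"
  have E[measurable]: "E \<in> sets borel" unfolding E_def using \<omega> by (intro visits_borel) simp
  have VE: "\<bar>V (\<omega> t)\<bar> \<le> \<delta> / 2 + C * indicator E t" for t
    using b[of "\<omega> t"] C(2)[of "\<omega> t"] N \<delta> by (cases "t \<in> E") (auto simp: E_def visits_def)
  have "((\<lambda>\<epsilon>. measure (expo \<epsilon>) E) \<longlongrightarrow> 0) (at_right 0)"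
    using occ_tendsto_0[OF null[of N]] by (intro expo_measure_tendsto_0 E) (simp add: occ_def E_def)
  then have "eventually (\<lambda>\<epsilon>. measure (expo \<epsilon>) E < \<delta> / (2 * C)) (at_right 0)"
    by (rule order_tendstoD) (use \<delta> C in simp)
  moreover have "eventually (\<lambda>\<epsilon>::real. 0 < \<epsilon>) (at_right 0)" by (rule eventually_at_right_less)
  ultimately show "eventually (\<lambda>\<epsilon>. dist (\<integral>t. V (\<omega> t) \<partial>expo \<epsilon>) 0 < \<delta>) (at_right 0)"
  proof eventually_elim
    case (elim \<epsilon>)
    interpret prob_space "expo \<epsilon>" using elim by (intro prob_space_expo)
    have int: "integrable (expo \<epsilon>) (\<lambda>t. \<bar>V (\<omega> t)\<bar>)"
      using C by (intro integrable_const_bound[of _ C]) auto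
    have "\<bar>\<integral>t. V (\<omega> t) \<partial>expo \<epsilon>\<bar> \<le> (\<integral>t. \<bar>V (\<omega> t)\<bar> \<partial>expo \<epsilon>)" by (rule integral_abs_bound)
    also have "\<dots> \<le> (\<integral>t. \<delta> / 2 + C * indicator E t \<partial>expo \<epsilon>)"
      using int VE by (intro integral_mono) (auto simp: emeasure_eq_measure)
    also have "\<dots> = \<delta> / 2 + C * measure (expo \<epsilon>) E"
      by (subst Bochner_Integration.integral_add) (auto simp: prob_space[simplified] emeasure_eq_measure)
    also have "\<dots> < \<delta> / 2 + C * (\<delta> / (2 * C))"
      using elim C by (intro add_strict_left_mono mult_strict_left_mono) auto
    also have "\<dots> = \<delta>" using C by simp
    finally show ?case by simp
  qed
qed

subsection \<open>The skew product\<close>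

lemma nn_integral_lborel_translate:
  fixes c :: "'a::euclidean_space"
  assumes [measurable]: "f \<in> borel_measurable borel"
  shows "(\<integral>\<^sup>+x. f (x + c) \<partial>lborel) = (\<integral>\<^sup>+x. f x \<partial>lborel)"
proof -
  have "(\<integral>\<^sup>+x. f x \<partial>lborel) = (\<integral>\<^sup>+x. f x \<partial>distr lborel borel ((+) c))"
    by (simp add: lborel_distr_plus)
  also have "\<dots> = (\<integral>\<^sup>+x. f (x + c) \<partial>lborel)"
    by (subst nn_integral_distr) (auto simp: add.commute)
  finally show ?thesis by simp
qed

locale stationary_increments = prob_space \<beta> for \<beta> :: "(real \<Rightarrow> 'a::euclidean_space) measure" +
  assumes sets_beta [measurable_cong]: "sets \<beta> = sets Omega0_M"
    and distr_shift: "distr \<beta> Omega0_M (shift t) = \<beta>"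
begin

text \<open>Lebesgue measure stands in for a law of the starting point: it makes the product
  invariant under the flow, at the price of infinite total mass.\<close>

abbreviation skew :: "((real \<Rightarrow> 'a) \<times> 'a) measure" where
  "skew \<equiv> \<beta> \<Otimes>\<^sub>M lborel"

lemma space_beta: "space \<beta> = Omega0"
  using sets_eq_imp_space_eq[OF sets_beta] by (simp add: space_Omega0_M)

lemma sets_skew: "sets skew = sets (Omega0_M \<Otimes>\<^sub>M borel)"
  by (rule sets_pair_measure_cong) (simp_all add: sets_beta)

lemma space_skew: "space skew = Omega0 \<times> UNIV"
  by (simp add: space_pair_measure space_beta)

lemma nn_integral_shift:
  assumes [measurable]: "f \<in> borel_measurable Omega0_M"
  shows "(\<integral>\<^sup>+\<omega>. f (shift t \<omega>) \<partial>\<beta>) = (\<integral>\<^sup>+\<omega>. f \<omega> \<partial>\<beta>)"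
proof -
  have "(\<integral>\<^sup>+\<omega>. f \<omega> \<partial>\<beta>) = (\<integral>\<^sup>+\<omega>. f \<omega> \<partial>distr \<beta> Omega0_M (shift t))"
    by (simp add: distr_shift)
  also have "\<dots> = (\<integral>\<^sup>+\<omega>. f (shift t \<omega>) \<partial>\<beta>)"
    by (rule nn_integral_distr) measurable
  finally show ?thesis by simp
qed

lemma emeasure_skew:
  assumes "A \<in> sets skew"
  shows "emeasure skew A = (\<integral>\<^sup>+\<omega>. (\<integral>\<^sup>+x. indicator A (\<omega>, x) \<partial>lborel) \<partial>\<beta>)"
  by (rule lborel.emeasure_pair_measure[OF assms])

text \<open>For a fixed path the flow translates the starting point by \<open>\<omega> t\<close>,
  which Lebesgue measure ignores; what remains is the invariance of \<open>\<beta>\<close> under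
  \<open>shift t\<close>.\<close>

lemma distr_skew_shift_pair: "distr skew skew (shift_pair t) = skew"
proof (rule measure_eqI)
  fix A assume "A \<in> sets (distr skew skew (shift_pair t))"
  then have A: "A \<in> sets skew" by simp
  then have A'[measurable]: "A \<in> sets (Omega0_M \<Otimes>\<^sub>M borel)" unfolding sets_skew .
  have T: "shift_pair t \<in> measurable skew skew" by measurable
  have "emeasure (distr skew skew (shift_pair t)) A = emeasure skew (shift_pair t -` A \<inter> space skew)"
    by (rule emeasure_distr[OF T A])
  also have "\<dots> = (\<integral>\<^sup>+\<omega>. (\<integral>\<^sup>+x. indicator (shift_pair t -` A \<inter> space skew) (\<omega>, x) \<partial>lborel) \<partial>\<beta>)"
    by (rule emeasure_skew[OF measurable_sets[OF T A]])
  also have "\<dots> = (\<integral>\<^sup>+\<omega>. (\<integral>\<^sup>+x. indicator A (shift t \<omega>, x + \<omega> t) \<partial>lborel) \<partial>\<beta>)"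
    by (intro nn_integral_cong) (auto simp: indicator_def shift_pair_def space_skew space_beta)
  also have "\<dots> = (\<integral>\<^sup>+\<omega>. (\<integral>\<^sup>+x. indicator A (shift t \<omega>, x) \<partial>lborel) \<partial>\<beta>)"
    by (intro nn_integral_cong nn_integral_lborel_translate)
      (use measurable_space[OF measurable_shift] in \<open>auto simp: space_beta space_Omega0_M\<close>)
  also have "\<dots> = (\<integral>\<^sup>+\<omega>. (\<integral>\<^sup>+x. indicator A (\<omega>, x) \<partial>lborel) \<partial>\<beta>)"
    by (rule nn_integral_shift) measurable
  also have "\<dots> = emeasure skew A" by (rule emeasure_skew[OF A, symmetric])
  finally show "emeasure (distr skew skew (shift_pair t)) A = emeasure skew A" .
qed simp

lemma sigma_finite_skew: "sigma_finite_measure skew"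
proof -
  interpret pair_sigma_finite \<beta> "lborel :: 'a measure" ..
  show ?thesis by (rule sigma_finite_measure_axioms)
qed

text \<open>After exchanging integrals, the starting points that put the path in the ball at time
  \<open>t\<close> form a translate of that ball. The finite value makes \<open>occ R 1\<close>
  integrable.\<close>

lemma nn_integral_occ:
  "(\<integral>\<^sup>+p. ennreal (occ R 1 p) \<partial>skew) = emeasure lborel (ball (0 :: 'a) R)"
proof -
  have "(\<integral>\<^sup>+p. ennreal (occ R 1 p) \<partial>skew) = (\<integral>\<^sup>+\<omega>. (\<integral>\<^sup>+x. ennreal (occ R 1 (\<omega>, x)) \<partial>lborel) \<partial>\<beta>)"
    by (rule lborel.nn_integral_fst[symmetric]) measurable
  also have "\<dots> = (\<integral>\<^sup>+\<omega>. emeasure lborel (ball (0 :: 'a) R) \<partial>\<beta>)"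
  proof (rule nn_integral_cong)
    fix \<omega> assume \<omega>: "\<omega> \<in> space \<beta>"
    then have [measurable]: "\<omega> \<in> borel_measurable borel"
      by (auto simp: space_beta Omega0_def intro: borel_measurable_continuous_onI)
    have "(\<integral>\<^sup>+x. ennreal (occ R 1 (\<omega>, x)) \<partial>lborel)
      = (\<integral>\<^sup>+x. \<integral>\<^sup>+t. indicator {0..<1} t * indicator (ball 0 R) (x + \<omega> t) \<partial>lborel \<partial>lborel)"
      using \<omega> by (intro nn_integral_cong) (simp add: ennreal_occ space_beta)
    also have "\<dots> = (\<integral>\<^sup>+t. \<integral>\<^sup>+x. indicator {0..<1} t * indicator (ball 0 R) (x + \<omega> t) \<partial>lborel \<partial>lborel)"
      by (rule lborel_pair.Fubini') measurable
    also have "\<dots> = (\<integral>\<^sup>+t. indicator {0..<1} t * (\<integral>\<^sup>+x. indicator (ball (0::'a) R) (x + \<omega> t) \<partial>lborel) \<partial>lborel)"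
      by (intro nn_integral_cong nn_integral_cmult) measurable
    also have "\<dots> = (\<integral>\<^sup>+t. indicator {0..<1::real} t * emeasure lborel (ball (0::'a) R) \<partial>lborel)"
      by (subst nn_integral_lborel_translate) auto
    also have "\<dots> = emeasure lborel (ball (0::'a) R)"
      by (subst nn_integral_multc) auto
    finally show "(\<integral>\<^sup>+x. ennreal (occ R 1 (\<omega>, x)) \<partial>lborel) = emeasure lborel (ball (0 :: 'a) R)" .
  qed
  finally show ?thesis by (simp add: emeasure_space_1)
qed

text \<open>An upper density above \<open>c\<close> forces \<open>occ R n p > c * n\<close> for some
  \<open>n\<close>, and the maximal inequality bounds the measure of the set where this
  happens.\<close>

lemma emeasure_upper_density_level_finite:
  assumes "0 < c"
  shows "emeasure skew {p \<in> space skew. ereal c < upper_density R p} < \<infinity>"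
proof -
  have T: "shift_pair 1 \<in> measurable skew skew" by measurable
  have int: "integrable skew (occ R 1)"
    by (rule integrableI_nonneg)
      (use nn_integral_occ[of R] emeasure_lborel_ball_finite[of "0::'a" R] in \<open>auto simp: occ_nonneg\<close>)
  have "emeasure skew {p \<in> space skew. ereal c < upper_density R p}
    \<le> emeasure skew {p \<in> space skew. \<exists>n. c * real n < (\<Sum>k<n. occ R 1 ((shift_pair 1 ^^ k) p))}"
  proof (rule emeasure_mono)
    show "{p \<in> space skew. ereal c < upper_density R p}
      \<subseteq> {p \<in> space skew. \<exists>n. c * real n < (\<Sum>k<n. occ R 1 ((shift_pair 1 ^^ k) p))}"
    proof safe
      fix \<omega> x assume p: "(\<omega>, x) \<in> space skew" and less: "ereal c < upper_density R (\<omega>, x)"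
      have "\<exists>n. c * real n < occ R n (\<omega>, x)"
      proof (rule ccontr)
        assume "\<not> ?thesis"
        then have "occ R n (\<omega>, x) / real n \<le> c" for n
          using assms by (cases "n = 0") (auto simp: not_less field_simps)
        then have "upper_density R (\<omega>, x) \<le> ereal c"
          unfolding upper_density_def by (intro Limsup_bounded always_eventually) auto
        then show False using less by simp
      qed
      then show "\<exists>n. c * real n < (\<Sum>k<n. occ R 1 ((shift_pair 1 ^^ k) (\<omega>, x)))"
        using p by (simp add: sum_occ[unfolded One_nat_def] space_skew)
    qed
    \<comment> \<open>Measurability is read off from the form with \<open>occ R n\<close>, which
      describes the same set as the form with iterates.\<close>
    have "{p \<in> space skew. \<exists>n. c * real n < occ R n p} \<in> sets skew" by measurable
    moreover have "{p \<in> space skew. \<exists>n. c * real n < occ R n p}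
        = {p \<in> space skew. \<exists>n. c * real n < (\<Sum>k<n. occ R 1 ((shift_pair 1 ^^ k) p))}"
      by (auto simp: sum_occ[unfolded One_nat_def] space_skew)
    ultimately show "{p \<in> space skew. \<exists>n. c * real n < (\<Sum>k<n. occ R 1 ((shift_pair 1 ^^ k) p))} \<in> sets skew"
      by simp
  qed
  also have "\<dots> \<le> ennreal (\<integral>z. \<bar>occ R 1 z\<bar> \<partial>skew) / ennreal c"
    by (rule Hopf_maximal_inequality[OF sigma_finite_skew T distr_skew_shift_pair int assms])
  also have "\<dots> < \<infinity>" using assms by (simp add: divide_ennreal)
  finally show ?thesis .
qed

lemma upper_density_level_sets: "{p \<in> space skew. ereal c < upper_density R p} \<in> sets skew"
  by measurable

lemma upper_density_level_invariant:
  "shift_pair t -` {p \<in> space skew. ereal c < upper_density R p} \<inter> space skew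
    = {p \<in> space skew. ereal c < upper_density R p}"
proof -
  have "shift_pair t p \<in> space skew" "upper_density R (shift_pair t p) = upper_density R p"
    if "p \<in> space skew" for p
    using that fst_shift_pair_in_Omega0[of p t]
    by (auto simp: space_skew mem_Times_iff upper_density_shift_pair)
  then show ?thesis by auto
qed

section \<open>From an invariant set of finite measure to a stationary law\<close>

text \<open>Cutting at the mean suffices: the invariant set \<open>{h \<le> a}\<close> has
  probability 0 or 1, so \<open>h\<close> lies almost surely on one side of its own mean
  \<open>a\<close>. Equality of the finite integrals then turns the inequality into equality, and
  rules out the strict case.\<close>

lemma ergodic_invariant_function_const:
  fixes h :: "(real \<Rightarrow> 'a) \<Rightarrow> ennreal"
  assumes erg: "ergodic_flow \<beta>" and h [measurable]: "h \<in> borel_measurable \<beta>"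
    and inv: "\<And>t \<omega>. \<omega> \<in> Omega0 \<Longrightarrow> h (shift t \<omega>) = h \<omega>"
    and a: "(\<integral>\<^sup>+\<omega>. h \<omega> \<partial>\<beta>) = a" "a < \<infinity>"
  shows "AE \<omega> in \<beta>. h \<omega> = a"
proof -
  define A where "A = {\<omega> \<in> space \<beta>. h \<omega> \<le> a}"
  have A: "A \<in> sets \<beta>" unfolding A_def by measurable
  have const: "(\<integral>\<^sup>+\<omega>. a \<partial>\<beta>) = a" by (simp add: emeasure_space_1)
  have "\<forall>t. shift t -` A \<inter> space \<beta> = A"
    by (auto simp: A_def space_beta inv shift_in_Omega0)
  with erg A have "emeasure \<beta> A = 0 \<or> emeasure \<beta> A = 1" by (auto simp: ergodic_flow_def)
  then show ?thesis
  proof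
    assume "emeasure \<beta> A = 0"
    then have "AE \<omega> in \<beta>. \<omega> \<notin> A" using A by (intro AE_not_in) (auto simp: null_sets_def)
    then have gt: "AE \<omega> in \<beta>. a < h \<omega>" 
      by (rule AE_mp) (auto simp: A_def not_le intro!: AE_I2)
    then have ge: "AE \<omega> in \<beta>. a \<le> h \<omega>" by eventually_elim simp
    \<comment> \<open>Subtraction in \<open>ennreal\<close> is truncated at 0, so the integral may
      be split only because of \<open>ge\<close>.\<close>
    have "(\<integral>\<^sup>+\<omega>. h \<omega> - a \<partial>\<beta>) = (\<integral>\<^sup>+\<omega>. h \<omega> \<partial>\<beta>) - (\<integral>\<^sup>+\<omega>. a \<partial>\<beta>)"
      by (intro nn_integral_diff ge) (use a const in auto)
    also have "\<dots> = 0" using a const by simp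
    finally have "AE \<omega> in \<beta>. h \<omega> - a = 0" by (subst (asm) nn_integral_0_iff_AE) auto
    then have "AE \<omega> in \<beta>. False"
      using gt by eventually_elim (auto dest: ennreal_minus_eq_0)
    then show ?thesis by simp
  next
    assume "emeasure \<beta> A = 1"
    then have "prob A = 1" by (simp add: measure_def)
    then have "AE \<omega> in \<beta>. \<omega> \<in> A" using A by (simp add: prob_eq_1)
    then have le: "AE \<omega> in \<beta>. h \<omega> \<le> a" by eventually_elim (auto simp: A_def)
    have "(\<integral>\<^sup>+\<omega>. a - h \<omega> \<partial>\<beta>) = (\<integral>\<^sup>+\<omega>. a \<partial>\<beta>) - (\<integral>\<^sup>+\<omega>. h \<omega> \<partial>\<beta>)"
      using le a by (intro nn_integral_diff) auto
    also have "\<dots> = 0" using a const by simp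
    finally have "AE \<omega> in \<beta>. a - h \<omega> = 0" by (subst (asm) nn_integral_0_iff_AE) auto
    then show ?thesis
      using le by eventually_elim (auto dest: ennreal_minus_eq_0)
  qed
qed

text \<open>Conditioning \<open>skew\<close> on \<open>D\<close> keeps invariance because
  \<open>D\<close> is invariant. The marginal on paths has density proportional to the Lebesgue
  measure of the sections of \<open>D\<close>; ergodicity makes this density constant.\<close>

theorem stationary_measure_of_invariant_set:
  assumes erg: "ergodic_flow \<beta>" and D: "D \<in> sets skew"
    and D_inv: "\<And>t. shift_pair t -` D \<inter> space skew = D"
    and D_pos: "0 < emeasure skew D" and D_fin: "emeasure skew D < \<infinity>"
  shows "\<exists>Q \<in> M_s. distr Q Omega0_M fst = \<beta>"
proof
  define Q where "Q = uniform_measure skew D"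
  have D'[measurable]: "D \<in> sets (Omega0_M \<Otimes>\<^sub>M borel)" using D unfolding sets_skew .
  have Q_sets[measurable_cong]: "sets Q = sets (Omega0_M \<Otimes>\<^sub>M borel)" by (simp only: Q_def sets_uniform_measure sets_skew)
  have Q_space: "space Q = space skew" by (simp add: Q_def)
  have Q_emeasure: "emeasure Q A = emeasure skew (D \<inter> A) / emeasure skew D" if "A \<in> sets skew" for A
    unfolding Q_def using D that by (rule emeasure_uniform_measure)
  have prob: "prob_space Q"
    unfolding Q_def using D_pos D_fin by (intro prob_space_uniform_measure) auto
  have Q_inv: "distr Q Omega0R_M (shift_pair t) = Q" for t
  proof (rule measure_eqI)
    show "sets (distr Q Omega0R_M (shift_pair t)) = sets Q" by (simp add: Omega0R_M_def Q_sets)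
    fix A assume "A \<in> sets (distr Q Omega0R_M (shift_pair t))"
    then have A'[measurable]: "A \<in> sets (Omega0_M \<Otimes>\<^sub>M borel)" by (simp add: Omega0R_M_def)
    then have A: "A \<in> sets skew" unfolding sets_skew .
    have T: "shift_pair t \<in> measurable skew skew" by measurable
    have TQ: "shift_pair t \<in> measurable Q Omega0R_M" unfolding Omega0R_M_def by measurable
    have "emeasure (distr Q Omega0R_M (shift_pair t)) A = emeasure Q (shift_pair t -` A \<inter> space skew)"
      using TQ A' by (subst emeasure_distr) (auto simp: Omega0R_M_def Q_space)
    also have "\<dots> = emeasure skew (D \<inter> (shift_pair t -` A \<inter> space skew)) / emeasure skew D"
      by (rule Q_emeasure[OF measurable_sets[OF T A]])
    \<comment> \<open>Invariance lets \<open>D\<close> be replaced by its own preimage, so the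
      intersection becomes a single preimage under the flow.\<close>
    also have "D \<inter> (shift_pair t -` A \<inter> space skew) = shift_pair t -` (D \<inter> A) \<inter> space skew"
      using D_inv[of t] by auto
    also have "emeasure skew \<dots> = emeasure (distr skew skew (shift_pair t)) (D \<inter> A)"
      using A D by (intro emeasure_distr[OF T, symmetric]) auto
    also have "\<dots> / emeasure skew D = emeasure Q A"
      using Q_emeasure[OF A] by (simp add: distr_skew_shift_pair)
    finally show "emeasure (distr Q Omega0R_M (shift_pair t)) A = emeasure Q A" .
  qed
  show "Q \<in> M_s"
    using prob Q_inv by (simp add: M_s_def Q_sets Omega0R_M_def)
  define h :: "(real \<Rightarrow> 'a) \<Rightarrow> ennreal" where "h \<omega> = (\<integral>\<^sup>+x. indicator D (\<omega>, x) \<partial>lborel)" for \<omega>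
  have h_meas[measurable]: "h \<in> borel_measurable Omega0_M" unfolding h_def[abs_def] by measurable
  have h_int: "(\<integral>\<^sup>+\<omega>. h \<omega> \<partial>\<beta>) = emeasure skew D"
    unfolding h_def by (rule emeasure_skew[OF D, symmetric])
  have h_inv: "h (shift t \<omega>) = h \<omega>" if "\<omega> \<in> Omega0" for t \<omega>
  proof -
    \<comment> \<open>The section of \<open>D\<close> over \<open>shift t \<omega>\<close> is the
      section over \<open>\<omega>\<close> translated by \<open>\<omega> t\<close>, hence of equal
      Lebesgue measure.\<close>
    have "indicator D (\<omega>, x) = (indicator D (shift t \<omega>, x + \<omega> t) :: ennreal)" for x
    proof -
      have "(\<omega>, x) \<in> D \<longleftrightarrow> shift_pair t (\<omega>, x) \<in> D"
        using D_inv[of t] that by (auto simp: space_skew)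
      then show ?thesis by (simp add: shift_pair_def indicator_def)
    qed
    then have "h \<omega> = (\<integral>\<^sup>+x. indicator D (shift t \<omega>, x + \<omega> t) \<partial>lborel)"
      unfolding h_def by simp
    also have "\<dots> = h (shift t \<omega>)"
      unfolding h_def
      by (rule nn_integral_lborel_translate)
        (use shift_in_Omega0[OF that] in \<open>auto simp: space_Omega0_M\<close>)
    finally show ?thesis by simp
  qed
  have h_const: "AE \<omega> in \<beta>. h \<omega> = emeasure skew D"
    using erg h_inv h_int D_fin by (intro ergodic_invariant_function_const) auto
  show "distr Q Omega0_M fst = \<beta>"
  proof (rule measure_eqI)
    show "sets (distr Q Omega0_M fst) = sets \<beta>" by (simp add: sets_beta)
    fix A assume "A \<in> sets (distr Q Omega0_M fst)"
    then have A[measurable]: "A \<in> sets Omega0_M" by simp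
    have Ab: "A \<in> sets \<beta>" by (simp add: sets_beta)
    have "emeasure (distr Q Omega0_M fst) A = emeasure Q (fst -` A \<inter> space skew)"
      by (subst emeasure_distr) (auto simp: Q_space)
    also have "\<dots> = emeasure skew (D \<inter> (fst -` A \<inter> space skew)) / emeasure skew D"
      by (rule Q_emeasure) measurable
    also have "emeasure skew (D \<inter> (fst -` A \<inter> space skew))
      = (\<integral>\<^sup>+\<omega>. (\<integral>\<^sup>+x. indicator (D \<inter> (fst -` A \<inter> space skew)) (\<omega>, x) \<partial>lborel) \<partial>\<beta>)"
      by (rule emeasure_skew) (use D in measurable)
    also have "\<dots> = (\<integral>\<^sup>+\<omega>. h \<omega> * indicator A \<omega> \<partial>\<beta>)"
      unfolding h_def
      by (intro nn_integral_cong) (auto simp: indicator_def space_skew space_beta intro!: nn_integral_cong)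
    also have "\<dots> = (\<integral>\<^sup>+\<omega>. emeasure skew D * indicator A \<omega> \<partial>\<beta>)"
      using h_const by (intro nn_integral_cong_AE) (auto elim!: eventually_mono)
    also have "\<dots> = emeasure skew D * emeasure \<beta> A"
      using Ab by (rule nn_integral_cmult_indicator)
    also have "\<dots> / emeasure skew D = emeasure \<beta> A"
      using D_pos D_fin mult_divide_eq_ennreal[of "emeasure skew D" "emeasure \<beta> A"]
      by (auto simp: mult.commute)
    finally show "emeasure (distr Q Omega0_M fst) A = emeasure \<beta> A" .
  qed
qed

text \<open>Positive density for paths started at 0 is a statement about a \<open>skew\<close>-null
  set of starting points. Enlarging the radius by 1 spreads it over the whole unit ball of starting
  points, a set of positive measure covered by countably many level sets, one of which must be
  charged.\<close>

theorem stationary_measure_if_positive_density: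
  assumes erg: "ergodic_flow \<beta>" and not_null: "\<not> (AE \<omega> in \<beta>. \<not> 0 < upper_density R (\<omega>, 0))"
  shows "\<exists>Q \<in> M_s. distr Q Omega0_M fst = \<beta>"
proof -
  define D where "D c = {p \<in> space skew. ereal c < upper_density (R + 1) p}" for c
  define B where "B = {\<omega> \<in> space \<beta>. 0 < upper_density R (\<omega>, 0)}"
  have B[measurable]: "B \<in> sets \<beta>" unfolding B_def by measurable
  have "emeasure \<beta> B \<noteq> 0"
  proof
    assume "emeasure \<beta> B = 0"
    then have "AE \<omega> in \<beta>. \<omega> \<notin> B" using B by (intro AE_not_in) (auto simp: null_sets_def)
    then have "AE \<omega> in \<beta>. \<not> 0 < upper_density R (\<omega>, 0)"
      by (rule AE_mp) (auto simp: B_def intro!: AE_I2)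
    with not_null show False by simp
  qed
  moreover have "emeasure lborel (ball (0::'a) 1) \<noteq> 0"
    using emeasure_lborel_ball_finite[of "0::'a" 1] content_ball_pos[of 1 "0::'a"]
    by (auto simp: measure_def)
  ultimately have pos: "emeasure skew (B \<times> ball 0 1) \<noteq> 0"
    by (subst lborel.emeasure_pair_measure_Times) auto
  have "B \<times> ball 0 1 \<subseteq> (\<Union>k. D (1 / real (Suc k)))"
  proof safe
    fix \<omega> and x :: 'a assume \<omega>: "\<omega> \<in> B" and x: "x \<in> ball 0 1"
    have "0 < upper_density R (\<omega>, 0)" using \<omega> by (simp add: B_def)
    also have "\<dots> \<le> upper_density (R + 1) (\<omega>, x)"
      using \<omega> x by (intro upper_density_mono) (auto simp: B_def space_beta)
    finally have "0 < upper_density (R + 1) (\<omega>, x)" .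
    then obtain r where r: "0 < r" "ereal r < upper_density (R + 1) (\<omega>, x)"
      using ereal_dense2[of 0 "upper_density (R + 1) (\<omega>, x)"] by (auto simp: zero_ereal_def)
    obtain k where "1 / real (Suc k) < r" using reals_Archimedean[OF r(1)] by (auto simp: inverse_eq_divide)
    then have "ereal (1 / real (Suc k)) < upper_density (R + 1) (\<omega>, x)"
      using r(2) by (metis less_ereal.simps(1) order_less_trans)
    then show "(\<omega>, x) \<in> (\<Union>k. D (1 / real (Suc k)))"
      using \<omega> by (auto simp: D_def space_skew B_def space_beta)
  qed
  then have "emeasure skew (B \<times> ball 0 1) \<le> emeasure skew (\<Union>k. D (1 / real (Suc k)))"
    unfolding D_def by (intro emeasure_mono) (measurable)
  with pos have "emeasure skew (\<Union>k. D (1 / real (Suc k))) \<noteq> 0" by auto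
  then have "\<exists>k. emeasure skew (D (1 / real (Suc k))) \<noteq> 0"
    using emeasure_UN_eq_0[of skew "\<lambda>k. D (1 / real (Suc k))"] upper_density_level_sets
    by (auto simp: D_def simp del: of_nat_Suc)
  then obtain k where "0 < emeasure skew (D (1 / real (Suc k)))" by (auto simp: zero_less_iff_neq_zero simp del: of_nat_Suc)
  then show ?thesis
    using stationary_measure_of_invariant_set[OF erg upper_density_level_sets upper_density_level_invariant,
        of "1 / real (Suc k)" "R + 1"] emeasure_upper_density_level_finite[of "1 / real (Suc k)" "R + 1"]
    by (simp add: D_def del: of_nat_Suc)
qed

section \<open>Convergence of the Abel means in expectation\<close>

text \<open>Almost sure convergence of the exponential means passes to the expectation by dominated
  convergence, with the bound of \<open>V\<close> as dominating constant.\<close>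

theorem mean_Abel_tendsto_0:
  fixes V :: "'a \<Rightarrow> real"
  assumes V: "continuous_on UNIV V" "((\<lambda>x. \<bar>V x\<bar>) \<longlongrightarrow> 0) at_infinity"
    and null: "\<And>N::nat. AE \<omega> in \<beta>. \<not> 0 < upper_density (real N) (\<omega>, 0)"
  shows "((\<lambda>\<epsilon>. \<integral>\<omega>. \<epsilon> * (LBINT t:{0..}. exp (- \<epsilon> * t) * V (\<omega> t - \<omega> 0)) \<partial>\<beta>)
    \<longlongrightarrow> 0) (at_right 0)"
proof -
  obtain C where C: "0 < C" "\<And>x. \<bar>V x\<bar> \<le> C" using vanishing_bounded[OF V] by blast
  have [measurable]: "V \<in> borel_measurable borel"
    using V by (auto intro: borel_measurable_continuous_onI)
  have eq: "(\<integral>\<omega>. \<epsilon> * (LBINT t:{0..}. exp (- \<epsilon> * t) * V (\<omega> t - \<omega> 0)) \<partial>\<beta>)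
    = (\<integral>\<omega>. (\<integral>t. V (\<omega> t) \<partial>expo \<epsilon>) \<partial>\<beta>)" if "0 < \<epsilon>" for \<epsilon>
  proof (rule Bochner_Integration.integral_cong)
    fix \<omega> assume "\<omega> \<in> space \<beta>"
    then have \<omega>: "\<omega> \<in> Omega0" by (simp add: space_beta)
    then have [measurable]: "\<omega> \<in> borel_measurable borel"
      by (auto simp: Omega0_def intro: borel_measurable_continuous_onI)
    have "\<omega> 0 = 0" using \<omega> by (simp add: Omega0_def)
    then show "\<epsilon> * (LBINT t:{0..}. exp (- \<epsilon> * t) * V (\<omega> t - \<omega> 0)) = (\<integral>t. V (\<omega> t) \<partial>expo \<epsilon>)"
      using Abel_mean_eq_expo[OF that, of "\<lambda>t. V (\<omega> t)"] by simp
  qed simp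
  \<comment> \<open>Integer radii keep the exceptional sets countable in number, so a single null
    set covers them all.\<close>
  have "AE \<omega> in \<beta>. \<forall>N::nat. \<not> 0 < upper_density (real N) (\<omega>, 0)"
    using null by (simp add: AE_all_countable)
  then have pointwise: "AE \<omega> in \<beta>. ((\<lambda>\<epsilon>. \<integral>t. V (\<omega> t) \<partial>expo \<epsilon>) \<longlongrightarrow> 0) (at_right 0)"
    by (rule AE_mp) (auto simp: space_beta intro!: AE_I2 expo_mean_tendsto_0[OF _ V])
  have "((\<lambda>\<epsilon>. \<integral>\<omega>. (\<integral>t. V (\<omega> t) \<partial>expo \<epsilon>) \<partial>\<beta>) \<longlongrightarrow> 0) (at_right 0)"
  \<comment> \<open>Dominated convergence is applied along arbitrary sequences decreasing to 0,
    which determine the one-sided limit.\<close>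
  proof (rule tendsto_at_right_sequentially)
    show "(0::real) < 1" by simp
    fix S :: "nat \<Rightarrow> real" assume S: "\<And>n. 0 < S n" "S \<longlonglongrightarrow> 0"
    have S_lim: "filterlim S (at_right 0) sequentially"
      using S by (auto simp: filterlim_at less_imp_neq[symmetric])
    have "(\<lambda>n. \<integral>\<omega>. (\<integral>t. V (\<omega> t) \<partial>expo (S n)) \<partial>\<beta>) \<longlonglongrightarrow> (\<integral>\<omega>. 0 \<partial>\<beta>)"
    proof (rule integral_dominated_convergence[where w = "\<lambda>_. C"])
      show "(\<lambda>\<omega>. \<integral>t. V (\<omega> t) \<partial>expo (S n)) \<in> borel_measurable \<beta>" for n
      proof -
        interpret e: prob_space "expo (S n)" using S by (intro prob_space_expo)
        have "(\<lambda>p. fst p (snd p)) \<in> borel_measurable (Omega0_M \<Otimes>\<^sub>M borel :: ((real \<Rightarrow> 'a) \<times> real) measure)"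
          by (rule measurable_Omega0_joint_eval)
        then have [measurable]: "(\<lambda>p. fst p (snd p)) \<in> borel_measurable (\<beta> \<Otimes>\<^sub>M expo (S n))"
          by (rule measurable_cong_sets[THEN equalityD1, THEN subsetD, rotated 2])
            (auto intro!: sets_pair_measure_cong simp: sets_beta)
        have "(\<lambda>p. V (fst p (snd p))) \<in> borel_measurable (\<beta> \<Otimes>\<^sub>M expo (S n))" by measurable
        then show ?thesis
          by (intro e.borel_measurable_lebesgue_integral) (simp add: case_prod_beta')
      qed
      show "AE \<omega> in \<beta>. (\<lambda>n. \<integral>t. V (\<omega> t) \<partial>expo (S n)) \<longlonglongrightarrow> 0"
        using pointwise by (rule AE_mp) (auto intro!: AE_I2 filterlim_compose[OF _ S_lim])
      show "AE \<omega> in \<beta>. norm (\<integral>t. V (\<omega> t) \<partial>expo (S n)) \<le> C" for n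
      proof (rule AE_I2)
        fix \<omega> assume "\<omega> \<in> space \<beta>"
        then have [measurable]: "\<omega> \<in> borel_measurable borel"
          by (auto simp: space_beta Omega0_def intro: borel_measurable_continuous_onI)
        interpret e: prob_space "expo (S n)" using S by (intro prob_space_expo)
        have int: "integrable (expo (S n)) (\<lambda>t. \<bar>V (\<omega> t)\<bar>)"
          using C by (intro e.integrable_const_bound[of _ C]) auto
        have "\<bar>\<integral>t. V (\<omega> t) \<partial>expo (S n)\<bar> \<le> (\<integral>t. \<bar>V (\<omega> t)\<bar> \<partial>expo (S n))"
          by (rule integral_abs_bound)
        also have "\<dots> \<le> C" using int C by (intro e.integral_le_const) auto
        finally show "norm (\<integral>t. V (\<omega> t) \<partial>expo (S n)) \<le> C" by simp
      qed
    qed auto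
    then show "(\<lambda>n. \<integral>\<omega>. (\<integral>t. V (\<omega> t) \<partial>expo (S n)) \<partial>\<beta>) \<longlonglongrightarrow> 0" by simp
  qed
  then show ?thesis
    by (rule tendsto_cong[THEN iffD2, rotated])
      (rule eventually_mono[OF eventually_at_right_less], rule eq)
qed

end

theorem theorem3p1:
  fixes \<beta> :: "(real \<Rightarrow> 'a::euclidean_space) measure"
  assumes "\<beta> \<in> M_si" and "ergodic_flow \<beta>"
  shows "(\<forall>V :: 'a \<Rightarrow> real. continuous_on UNIV V \<and> ((\<lambda>x. \<bar>V x\<bar>) \<longlongrightarrow> 0) at_infinity \<longrightarrow>
            ((\<lambda>\<epsilon>. \<integral>\<omega>. \<epsilon> * (LBINT t:{0..}. exp (- \<epsilon> * t) * V (\<omega> t - \<omega> 0)) \<partial>\<beta>)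
               \<longlongrightarrow> 0) (at_right 0))
       \<or> (\<exists>Q \<in> M_s. distr Q Omega0_M fst = \<beta>)"
proof -
  interpret stationary_increments \<beta>
    using assms(1) by (auto simp: M_si_def stationary_increments_def stationary_increments_axioms_def)
  show ?thesis
  \<comment> \<open>The dichotomy is whether almost every path started at 0 spends a vanishing
    fraction of time in each ball of integer radius.\<close>
  proof (cases "\<forall>N::nat. AE \<omega> in \<beta>. \<not> 0 < upper_density (real N) (\<omega>, 0)")
    case True
    then show ?thesis using mean_Abel_tendsto_0 by blast
  next
    case False
    then show ?thesis using stationary_measure_if_positive_density[OF assms(2)] by blast
  qed
qed

end
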